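(* Let $\langle\phi,\vec a\rangle$ be a loop. If \[ \langle\!\langle\top\mid\top\mid\phi\rangle\!\rangle_{\vec a}\leadsto_{\mathit{nt}}^*\langle\!\langle\psi\mid\check\phi\mid\top\rangle\!\rangle_{\vec a} \] and $\psi$ is satisfiable, then $\psi$ is a certificate of non-termination for $\langle\phi,\vec a\rangle$.
   Context: Fix $d\ge 1$ and integer variables $\vec x=(x_1,\dots,x_d)$. A loop $\langle\phi,\vec a\rangle$ consists of a quantifier-free formula $\phi$ over atoms $p>0$ ($p$ an arithmetic expression over $\vec x$, integer semantics) and a map $\vec a:\mathbb Z^d\to\mathbb Z^d$ given by expressions over $\vec x$; $\vec a^m$ is $m$-fold application ($\vec a^0=\mathrm{id}$); $\top$ denotes truth. A vector $\vec x\in\mathbb Z^d$ is a witness of non-termination for $\langle\phi,\vec a\rangle$ if $\phi(\vec a^m(\vec x))$ holds for all $m\in\mathbb N$. A quantifier-free formula $\eta$ over $\vec x$ is a certificate of non-termination for the loop if $\eta$ is satisfiable and every $\vec x\in\mathbb Z^d$ with $\eta(\vec x)$ is a witness of non-termination. A conditional non-termination technique is a partial function $\mathit{nt}$ mapping pairs (loop $\langle\chi,\vec a\rangle$, quantifier-free formula $\check\phi$ over $\vec x$) to quantifier-free formulas over $\vec x$ such that for all $(\langle\chi,\vec a\rangle,\check\phi)$ in its domain and all $\vec x\in\mathbb Z^d$: if $\vec x$ is a witness of non-termination for $\langle\check\phi,\vec a\rangle$ and $\mathit{nt}(\langle\chi,\vec a\rangle,\check\phi)(\vec x)$ holds, then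 $\vec x$ is a witness of non-termination for $\langle\chi,\vec a\rangle$. Formulas are in CNF and identified with their sets of clauses. A non-termination problem is a tuple $\langle\!\langle\psi\mid\check\phi\mid\hat\phi\rangle\!\rangle_{\vec a}$ with $\psi,\check\phi,\hat\phi$ quantifier-free formulas over $\vec x$ and $\vec a:\mathbb Z^d\to\mathbb Z^d$. The relation $\leadsto_{\mathit{nt}}$ is defined by: $\langle\!\langle\psi_1\mid\check\phi\mid\hat\phi\rangle\!\rangle_{\vec a}\leadsto_{\mathit{nt}}\langle\!\langle\psi_1\cup\psi_2\mid\check\phi\cup\chi\mid\hat\phi\setminus\chi\rangle\!\rangle_{\vec a}$ whenever $\emptyset\ne\chi\subseteq\hat\phi$ (as sets of clauses) and $\mathit{nt}(\langle\chi,\vec a\rangle,\check\phi)=\psi_2$ for some conditional non-termination technique $\mathit{nt}$; $\leadsto_{\mathit{nt}}^*$ is its reflexive-transitive closure. *)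

theory Defs
  imports "HOL-Analysis.Finite_Cartesian_Product" "HOL-Library.FSet"
begin

text \<open>
  The variables \<open>x\<^sub>1, \<dots>, x\<^sub>d\<close> are indexed by a finite type \<open>'d\<close>, so that \<open>d = CARD('d) \<ge> 1\<close>, and
  elements of \<open>\<int>\<^sup>d\<close> have type \<open>int ^ 'd\<close>.

  Expressions are evaluated over the integers. All operations are total: \<open>Div\<close> is floor division
  with \<open>z div 0 = 0\<close>, and a negative exponent counts as exponent \<open>0\<close>. These choices do not restrict
  the class of definable functions: \<open>0 ^ nat k\<close> is \<open>1\<close> if \<open>k \<le> 0\<close> and \<open>0\<close> otherwise, so case
  distinctions on signs, and thereby truncating division or other values for the exceptional cases,
  are expressible.
\<close>

datatype 'd aexp =
    Const int
  | Var 'd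
  | Add "'d aexp" "'d aexp"
  | Sub "'d aexp" "'d aexp"
  | Mul "'d aexp" "'d aexp"
  | Div "'d aexp" "'d aexp"
  | Exp "'d aexp" "'d aexp"

primrec aval :: "'d::finite aexp \<Rightarrow> int ^ 'd \<Rightarrow> int" where
  "aval (Const c) x = c"
| "aval (Var i) x = x $ i"
| "aval (Add p q) x = aval p x + aval q x"
| "aval (Sub p q) x = aval p x - aval q x"
| "aval (Mul p q) x = aval p x * aval q x"
| "aval (Div p q) x = aval p x div aval q x"
| "aval (Exp p q) x = aval p x ^ nat (aval q x)"

text \<open>\<open>Pos p\<close> is the atom \<open>p > 0\<close>, and \<open>Neg p\<close> is its negation.\<close>

datatype 'd literal = Pos "'d aexp" | Neg "'d aexp"

primrec literal_holds :: "'d::finite literal \<Rightarrow> int ^ 'd \<Rightarrow> bool" where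
  "literal_holds (Pos p) x \<longleftrightarrow> aval p x > 0"
| "literal_holds (Neg p) x \<longleftrightarrow> \<not> aval p x > 0"

text \<open>
  A quantifier-free formula in CNF is a finite set of clauses, and a clause is a finite set of
  literals. Hence conjunction is union, and truth is the empty set of clauses.
\<close>

type_synonym 'd clause = "'d literal fset"
type_synonym 'd formula = "'d clause fset"

abbreviation truth :: "'d formula" where
  "truth \<equiv> {||}"

definition clause_holds :: "'d::finite clause \<Rightarrow> int ^ 'd \<Rightarrow> bool" where
  "clause_holds C x \<longleftrightarrow> (\<exists>l. l |\<in>| C \<and> literal_holds l x)"

definition holds :: "'d::finite formula \<Rightarrow> int ^ 'd \<Rightarrow> bool" where
  "holds \<phi> x \<longleftrightarrow> (\<forall>C. C |\<in>| \<phi> \<longrightarrow> clause_holds C x)"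

definition satisfiable :: "'d::finite formula \<Rightarrow> bool" where
  "satisfiable \<phi> \<longleftrightarrow> (\<exists>x. holds \<phi> x)"

type_synonym 'd update = "int ^ 'd \<Rightarrow> int ^ 'd"

definition given_by_expressions :: "'d::finite update \<Rightarrow> bool" where
  "given_by_expressions a \<longleftrightarrow> (\<exists>e :: 'd aexp ^ 'd. \<forall>x. a x = (\<chi> i. aval (e $ i) x))"

text \<open>A value of type \<open>'d pre_loop\<close> is a loop if its update is given by expressions.\<close>

type_synonym 'd pre_loop = "'d formula \<times> 'd update"

definition is_loop :: "'d::finite pre_loop \<Rightarrow> bool" where
  "is_loop L \<longleftrightarrow> given_by_expressions (snd L)"

definition nonterm_witness :: "'d::finite pre_loop \<Rightarrow> int ^ 'd \<Rightarrow> bool" where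
  "nonterm_witness L x \<longleftrightarrow> (\<forall>m::nat. holds (fst L) ((snd L ^^ m) x))"

definition nonterm_certificate :: "'d::finite pre_loop \<Rightarrow> 'd formula \<Rightarrow> bool" where
  "nonterm_certificate L \<eta> \<longleftrightarrow>
     satisfiable \<eta> \<and> (\<forall>x. holds \<eta> x \<longrightarrow> nonterm_witness L x)"

definition cond_nonterm_technique ::
    "('d::finite pre_loop \<times> 'd formula \<rightharpoonup> 'd formula) \<Rightarrow> bool" where
  "cond_nonterm_technique nt \<longleftrightarrow>
     (\<forall>\<xi> a \<phi>c \<psi>. nt ((\<xi>, a), \<phi>c) = Some \<psi> \<longrightarrow>
        is_loop (\<xi>, a) \<and>
        (\<forall>x. nonterm_witness (\<phi>c, a) x \<and> holds \<psi> x \<longrightarrow> nonterm_witness (\<xi>, a) x))"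

text \<open>\<open>NT \<psi> \<phi>c \<phi>h a\<close> is the non-termination problem \<open>\<langle>\<langle>\<psi> | \<phi>c | \<phi>h\<rangle>\<rangle>\<^sub>a\<close>, where \<open>\<phi>c\<close> and \<open>\<phi>h\<close> are
  the formulas usually written with a check and a hat.\<close>

datatype 'd nt_problem = NT "'d formula" "'d formula" "'d formula" "'d update"

inductive nt_step :: "'d::finite nt_problem \<Rightarrow> 'd nt_problem \<Rightarrow> bool" (infix "\<leadsto>nt" 50) where
  "\<lbrakk>\<xi> \<noteq> {||}; \<xi> |\<subseteq>| \<phi>h; cond_nonterm_technique nt; nt ((\<xi>, a), \<phi>c) = Some \<psi>\<^sub>2\<rbrakk> \<Longrightarrow>
   NT \<psi>\<^sub>1 \<phi>c \<phi>h a \<leadsto>nt NT (\<psi>\<^sub>1 |\<union>| \<psi>\<^sub>2) (\<phi>c |\<union>| \<xi>) (\<phi>h |-| \<xi>) a"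

abbreviation nt_steps :: "'d::finite nt_problem \<Rightarrow> 'd nt_problem \<Rightarrow> bool" (infix "\<leadsto>nt*" 50) where
  "P \<leadsto>nt* Q \<equiv> nt_step\<^sup>*\<^sup>* P Q"

end

theory Submission
  imports Defs
begin

text \<open>An invariant holds along every derivation: handled and pending clauses together make up
  \<open>\<phi>\<close>, and each model of the first component is a witness for the handled clauses.
  A step keeps it (\<open>sound_problem_step\<close>), because a technique may presuppose
  non-termination for exactly those clauses, and being a witness commutes with conjunction
  (\<open>nonterm_witness_union\<close>). Once nothing is pending, the handled clauses are all of
  \<open>\<phi>\<close>.\<close>

lemma nonterm_witness_truth: "nonterm_witness (truth, a) x"
  by (simp add: nonterm_witness_def holds_def)

lemma holds_union: "holds (\<phi> |\<union>| \<psi>) x \<longleftrightarrow> holds \<phi> x \<and> holds \<psi> x"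
  by (auto simp: holds_def)

lemma nonterm_witness_union:
  "nonterm_witness (\<phi> |\<union>| \<psi>, a) x \<longleftrightarrow> nonterm_witness (\<phi>, a) x \<and> nonterm_witness (\<psi>, a) x"
  by (auto simp: nonterm_witness_def holds_union)

text \<open>The invariant. Fixing \<open>\<phi>\<close> and \<open>a\<close> as parameters ties
  every intermediate problem to the original loop.\<close>

definition sound_problem :: "'d::finite formula \<Rightarrow> 'd update \<Rightarrow> 'd nt_problem \<Rightarrow> bool" where
  "sound_problem \<phi> a P \<longleftrightarrow>
     (\<exists>\<psi> \<phi>c \<phi>h. P = NT \<psi> \<phi>c \<phi>h a \<and> \<phi>c |\<union>| \<phi>h = \<phi> \<and>
        (\<forall>x. holds \<psi> x \<longrightarrow> nonterm_witness (\<phi>c, a) x))"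

lemma sound_problem_step:
  assumes "P \<leadsto>nt Q" and "sound_problem \<phi> a P"
  shows "sound_problem \<phi> a Q"
  using assms
proof cases
  case (1 \<xi> \<phi>h nt b \<phi>c \<psi>\<^sub>2 \<psi>\<^sub>1)
  have b: "b = a" and part: "\<phi>c |\<union>| \<phi>h = \<phi>"
    and wit: "\<And>x. holds \<psi>\<^sub>1 x \<Longrightarrow> nonterm_witness (\<phi>c, a) x"
    using assms(2) 1(1) by (auto simp: sound_problem_def)
  have "nonterm_witness (\<phi>c |\<union>| \<xi>, a) x" if "holds (\<psi>\<^sub>1 |\<union>| \<psi>\<^sub>2) x" for x
  proof -
    have "nonterm_witness (\<phi>c, a) x" and "holds \<psi>\<^sub>2 x"
      using that wit by (auto simp: holds_union)
    \<comment> \<open>The invariant supplies the premise about \<open>\<phi>c\<close> under which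
      the technique is sound.\<close>
    moreover from this have "nonterm_witness (\<xi>, a) x"
      using 1(5,6) unfolding b cond_nonterm_technique_def by blast
    ultimately show ?thesis by (simp add: nonterm_witness_union)
  qed
  \<comment> \<open>As \<open>\<xi>\<close> lies within \<open>\<phi>h\<close>, moving it across
    introduces no foreign clause.\<close>
  moreover have "(\<phi>c |\<union>| \<xi>) |\<union>| (\<phi>h |-| \<xi>) = \<phi>"
    using part 1(4) by blast
  ultimately show ?thesis
    using 1(2) b by (auto simp: sound_problem_def)
qed

lemma sound_problem_steps:
  assumes "P \<leadsto>nt* Q" and "sound_problem \<phi> a P"
  shows "sound_problem \<phi> a Q"
  using assms by (induction rule: rtranclp_induct) (auto intro: sound_problem_step)

theorem theorem14:
  fixes \<phi> \<psi> \<phi>c :: "'d::finite formula"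
    and a :: "int ^ 'd \<Rightarrow> int ^ 'd"
  assumes "is_loop (\<phi>, a)"
    and "NT truth truth \<phi> a \<leadsto>nt* NT \<psi> \<phi>c truth a"
    and "satisfiable \<psi>"
  shows "nonterm_certificate (\<phi>, a) \<psi>"
proof -
  have "sound_problem \<phi> a (NT truth truth \<phi> a)"
    by (simp add: sound_problem_def nonterm_witness_truth)
  with assms(2) have "sound_problem \<phi> a (NT \<psi> \<phi>c truth a)"
    by (rule sound_problem_steps)
  \<comment> \<open>With no clause pending, the invariant's equation becomes
    \<open>\<phi>c = \<phi>\<close>.\<close>
  with assms(3) show ?thesis
    by (auto simp: sound_problem_def nonterm_certificate_def)
qed

end
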